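(* Let $\mathbb K$ be a field of characteristic zero and let $S:=\{a_1,\dots,a_n\}$ be a set of $n$ linearly independent, mutually commuting $n\times n$ matrices with entries in $\mathbb K$. Let $\mathfrak B$ be the $\mathbb K$-vector space spanned by $a_1,\dots,a_n$, and suppose that, as an $n$-dimensional Abelian Lie subalgebra of $\mathfrak{gl}(n,\mathbb K)$, it acts on $(\mathbb K^n)^*$ with an open orbit via $\rho^*:\mathfrak B\times(\mathbb K^n)^*\to(\mathbb K^n)^*$, $(a,f)\mapsto\rho^*(a)f:=-f\circ a$. For any integer $p$ with $1\le p\le n$ and any subset $\{a_{i_1},\dots,a_{i_p}\}$ of $p$ elements of $S$, let $\mathbb K[a_{i_1},\dots,a_{i_p}]$ be the commutative associative $\mathbb K$-algebra of all polynomials in $a_{i_1},\dots,a_{i_p}$ with coefficients in $\mathbb K$. Then $$\dim\mathbb K[a_{i_1},\dots,a_{i_p}]\le n ,$$ and in particular $\mathbb K[a_1,\dots,a_n]=\mathfrak B$.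
   Context: The action $\rho^*$ of $\mathfrak B$ on $(\mathbb K^n)^*$ is said to have an open orbit if there is $\alpha\in(\mathbb K^n)^*$ such that $\{\rho^*(a)\alpha: a\in\mathfrak B\}=(\mathbb K^n)^*$. Polynomials may have constant terms, the constant $1$ being evaluated as the identity matrix. *)

theory Defs
  imports "HOL-Analysis.Cartesian_Space"
begin

text \<open>
  Square matrices are elements of \<open>'a^'n^'n\<close> with product \<open>(**)\<close> and identity \<open>mat 1\<close>, and
  \<open>CARD('n)\<close> is the size of the matrices. The type-class operations \<open>(*)\<close>, \<open>1\<close> and \<open>(^)\<close> on this
  type are componentwise and are not used. The library provides scalar multiplication by elements
  of the base field for vectors (\<open>(*s)\<close>), but not for matrices, so it is introduced here.
\<close>

definition mat_scale :: "'a::field \<Rightarrow> 'a^'n^'m \<Rightarrow> 'a^'n^'m"  (infixr \<open>*\<^sub>m\<close> 75)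
  where "c *\<^sub>m A = map_matrix ((*) c) A"

lemma mat_scale_nth [simp]: "(c *\<^sub>m A) $ i $ j = c * A $ i $ j"
  by (simp add: mat_scale_def map_matrix_def)

definition mat_units :: "('a::field^'n^'m) set"
  where "mat_units = range (\<lambda>(i, j). axis i (axis j 1))"

interpretation mats: vector_space "(*\<^sub>m) :: 'a::field \<Rightarrow> 'a^'n^'m \<Rightarrow> 'a^'n^'m"
  by unfold_locales (simp_all add: vec_eq_iff algebra_simps)

lemma inj_mat_unit: "inj (\<lambda>(i, j). axis i (axis j 1) :: 'a::field^'n^'m)"
  by (auto simp: inj_def axis_eq_axis)

lemma sum_mat_units_nth:
  fixes f :: "'a::field^'n^'m \<Rightarrow> 'a"
  shows "(\<Sum>A\<in>mat_units. f A *\<^sub>m A) $ i $ j = f (axis i (axis j 1))"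
proof -
  have "(\<Sum>A\<in>mat_units. f A *\<^sub>m A) $ i $ j
      = (\<Sum>p\<in>UNIV. (f (axis (fst p) (axis (snd p) 1)) *\<^sub>m axis (fst p) (axis (snd p) 1)) $ i $ j)"
    unfolding mat_units_def
    by (subst sum.reindex[OF inj_mat_unit]) (simp add: sum_component case_prod_beta)
  also have "\<dots> = (\<Sum>p\<in>UNIV. if p = (i, j) then f (axis i (axis j 1)) else 0)"
    by (intro sum.cong) (auto simp: axis_def)
  finally show ?thesis by simp
qed

interpretation mats: finite_dimensional_vector_space
  "(*\<^sub>m) :: 'a::field \<Rightarrow> 'a^'n^'m \<Rightarrow> 'a^'n^'m" mat_units
proof unfold_locales
  show fin: "finite (mat_units :: ('a^'n^'m) set)"
    by (simp add: mat_units_def)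
  show "mats.independent (mat_units :: ('a^'n^'m) set)"
  proof (rule mats.independent_if_scalars_zero[OF fin])
    fix f :: "'a^'n^'m \<Rightarrow> 'a" and A :: "'a^'n^'m"
    assume "(\<Sum>A\<in>mat_units. f A *\<^sub>m A) = 0" "A \<in> mat_units"
    then show "f A = 0"
      by (auto simp: mat_units_def simp flip: sum_mat_units_nth)
  qed
  show "mats.span mat_units = (UNIV :: ('a^'n^'m) set)"
  proof safe
    fix A :: "'a^'n^'m"
    let ?e = "\<lambda>(i, j). axis i (axis j 1) :: 'a^'n^'m"
    define f where "f U = A $ fst (inv ?e U) $ snd (inv ?e U)" for U
    have "inv ?e (axis i (axis j 1)) = (i, j)" for i j
      using inv_f_f[OF inj_mat_unit[where 'a = 'a], of "(i, j)"] by simp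
    then have "A = (\<Sum>U\<in>mat_units. f U *\<^sub>m U)"
      by (subst vec_eq_iff, subst vec_eq_iff) (simp add: sum_mat_units_nth f_def del: sum_component)
    then show "A \<in> mats.span mat_units"
      by (metis (lifting) mats.span_base mats.span_scale mats.span_sum)
  qed simp
qed

definition dual_space :: "('a::field^'n \<Rightarrow> 'a) set"
  where "dual_space = {f. Vector_Spaces.linear (*s) (*) f}"

definition dual_action :: "'a::field^'n^'n \<Rightarrow> ('a^'n \<Rightarrow> 'a) \<Rightarrow> ('a^'n \<Rightarrow> 'a)"
  where "dual_action A f = - (f \<circ> (\<lambda>v. A *v v))"

definition has_open_orbit :: "('a::field^'n^'n) set \<Rightarrow> bool"
  where "has_open_orbit B \<longleftrightarrow>
    (\<exists>\<alpha>\<in>dual_space. {dual_action A \<alpha> | A. A \<in> B} = dual_space)"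

definition mat_prod_list :: "('a::field^'n^'n) list \<Rightarrow> 'a^'n^'n"
  where "mat_prod_list As = foldr (**) As (mat 1)"

text \<open>
  The values at \<open>T\<close> of all polynomials: linear combinations of monomials in the elements of \<open>T\<close>.
  A monomial is given by the list of its factors, the empty list being the constant monomial \<open>1\<close>.
  The order of the factors is irrelevant when the elements of \<open>T\<close> commute, which is the only case
  in which this definition is used.
\<close>

definition poly_algebra :: "('a::field^'n^'n) set \<Rightarrow> ('a^'n^'n) set"
  where "poly_algebra T = mats.span {mat_prod_list As | As. set As \<subseteq> T}"

end

theory Submission
  imports Defs
begin

text \<open>
  Let \<open>\<alpha>\<close> generate the open orbit of \<open>B\<close>. If \<open>C\<close> commutes with \<open>B\<close>, then \<open>\<alpha> \<circ> C = \<alpha> \<circ> A\<close> for some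
  \<open>A \<in> B\<close>, so \<open>D = C - A\<close> commutes with \<open>B\<close> and satisfies \<open>\<alpha> \<circ> D = 0\<close>. Every functional has the form
  \<open>\<alpha> \<circ> A'\<close> with \<open>A' \<in> B\<close>, and \<open>\<alpha> \<circ> A' \<circ> D = \<alpha> \<circ> D \<circ> A' = 0\<close>; hence \<open>D = 0\<close> and \<open>C = A \<in> B\<close>.
  Thus \<open>B\<close> contains its own commutant, and in particular all polynomials in elements of \<open>S\<close>.
\<close>

lemma mat_scale_mult_left: "(c *\<^sub>m A) ** B = c *\<^sub>m (A ** B)"
  by (simp add: vec_eq_iff matrix_matrix_mult_def sum_distrib_left mult.assoc)

lemma mat_scale_mult_right: "A ** (c *\<^sub>m B) = c *\<^sub>m (A ** B)"
  by (simp add: vec_eq_iff matrix_matrix_mult_def sum_distrib_left mult.left_commute)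

lemma matrix_add_rdistrib: "(A + B) ** C = A ** C + B ** C"
  by (simp add: vec_eq_iff matrix_matrix_mult_def sum.distrib distrib_right)

text \<open>Linearity of both products in \<open>A\<close>. Used to pass commutation with a fixed
  matrix to spans and to differences.\<close>

lemma subspace_commutant: "mats.subspace {A :: 'a::field^'n^'n. A ** C = C ** A}"
  by (auto simp: mats.subspace_def mat_scale_mult_left mat_scale_mult_right
      matrix_add_ldistrib matrix_add_rdistrib)

lemma span_commute:
  fixes C :: "'a::field^'n^'n"
  assumes "\<And>A. A \<in> S \<Longrightarrow> A ** C = C ** A" and "A \<in> mats.span S"
  shows "A ** C = C ** A"
  using mats.span_minimal[OF _ subspace_commutant, of S C] assms by blast

lemma mat_prod_list_commute:
  fixes C :: "'a::field^'n^'n"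
  assumes "\<And>A. A \<in> set As \<Longrightarrow> A ** C = C ** A"
  shows "mat_prod_list As ** C = C ** mat_prod_list As"
  using assms
proof (induction As)
  case (Cons A As)
  have "(A ** mat_prod_list As) ** C = A ** (C ** mat_prod_list As)"
    using Cons by (simp flip: matrix_mul_assoc)
  also have "\<dots> = C ** (A ** mat_prod_list As)"
    using Cons.prems[of A] by (simp add: matrix_mul_assoc)
  finally show ?case
    by (simp add: mat_prod_list_def)
qed (simp add: mat_prod_list_def)

lemma dual_spaceI:
  fixes f :: "'a::field^'n \<Rightarrow> 'a"
  assumes "\<And>v w. f (v + w) = f v + f w" and "\<And>c v. f (c *s v) = c * f v"
  shows "f \<in> dual_space"
  unfolding dual_space_def mem_Collect_eq
  by unfold_locales (simp_all add: assms algebra_simps)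

lemma dual_space_linear:
  assumes "f \<in> dual_space"
  shows "f (v + w) = f v + f w" and "f (c *s v) = c * f v" and "f (v - w) = f v - f w"
proof -
  interpret Vector_Spaces.linear "(*s)" "(*)" f
    using assms by (simp add: dual_space_def)
  show "f (v + w) = f v + f w" "f (c *s v) = c * f v" "f (v - w) = f v - f w"
    by (rule add scale diff)+
qed

lemma dual_action_in_dual_space:
  assumes "f \<in> dual_space"
  shows "dual_action A f \<in> dual_space"
  by (rule dual_spaceI)
    (simp_all add: dual_action_def dual_space_linear[OF assms] matrix_vector_right_distrib
      vector_scalar_commute)

lemma open_orbit_commutant_subset:
  fixes B :: "('a::field^'n^'n) set"
  assumes orbit: "has_open_orbit B"
    and comm: "\<And>A A'. A \<in> B \<Longrightarrow> A' \<in> B \<Longrightarrow> A ** A' = A' ** A"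
    and C: "\<And>A. A \<in> B \<Longrightarrow> A ** C = C ** A"
  shows "C \<in> B"
proof -
  obtain \<alpha> where \<alpha>: "\<alpha> \<in> dual_space"
    and all: "{dual_action A \<alpha> | A. A \<in> B} = dual_space"
    using orbit unfolding has_open_orbit_def by blast
  have "dual_action C \<alpha> \<in> {dual_action A \<alpha> | A. A \<in> B}"
    unfolding all by (rule dual_action_in_dual_space[OF \<alpha>])
  then obtain A where A: "A \<in> B" "dual_action C \<alpha> = dual_action A \<alpha>"
    by blast
  define D where "D = C - A"
  \<comment> \<open>Both \<open>C\<close> and \<open>A\<close> lie in the commutant of
    \<open>A'\<close>, a subspace, so their difference does too.\<close>
  have D_comm: "A' ** D = D ** A'" if "A' \<in> B" for A'
    using mats.subspace_diff[OF subspace_commutant, of C A' A] C[OF that] comm[OF that A(1)]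
    by (simp add: D_def)
  have \<alpha>_D: "\<alpha> (D *v v) = 0" for v
    using fun_cong[OF A(2), of v]
    by (simp add: D_def dual_action_def matrix_vector_mult_diff_rdistrib dual_space_linear[OF \<alpha>])
  have "(D *v v) $ i = 0" for v i
  proof -
    \<comment> \<open>The coordinate functionals suffice to detect \<open>D = 0\<close>, and each of
      them lies in the orbit of \<alpha>.\<close>
    have "(\<lambda>v. v $ i) \<in> {dual_action A \<alpha> | A. A \<in> B}"
      unfolding all by (rule dual_spaceI) simp_all
    then obtain A' where A': "A' \<in> B" "(\<lambda>v. v $ i) = dual_action A' \<alpha>"
      by blast
    have "(D *v v) $ i = - \<alpha> ((A' ** D) *v v)"
      using fun_cong[OF A'(2), of "D *v v"]
      by (simp add: dual_action_def matrix_vector_mul_assoc)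
    \<comment> \<open>Commuting brings \<open>D\<close> directly under \<alpha>, which vanishes on
      its range.\<close>
    also have "\<dots> = - \<alpha> (D *v (A' *v v))"
      by (simp add: D_comm[OF A'(1)] matrix_vector_mul_assoc)
    finally show ?thesis
      by (simp add: \<alpha>_D)
  qed
  then have "D = 0"
    by (simp add: matrix_eq vec_eq_iff)
  with A(1) show ?thesis
    by (simp add: D_def)
qed

text \<open>A monomial in \<open>T\<close> commutes with \<open>S\<close>, hence with its span, and
  so belongs to that span by \<open>open_orbit_commutant_subset\<close>. Linear combinations
  follow.\<close>

lemma poly_algebra_subset_span:
  fixes S :: "('a::field^'n^'n) set"
  assumes comm: "\<And>A A'. A \<in> S \<Longrightarrow> A' \<in> S \<Longrightarrow> A ** A' = A' ** A"
    and orbit: "has_open_orbit (mats.span S)" and "T \<subseteq> S"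
  shows "poly_algebra T \<subseteq> mats.span S"
  unfolding poly_algebra_def
proof (rule mats.span_minimal)
  show "{mat_prod_list As | As. set As \<subseteq> T} \<subseteq> mats.span S"
  proof clarify
    fix As assume As: "set As \<subseteq> T"
    have prod_comm: "A ** mat_prod_list As = mat_prod_list As ** A" if "A \<in> S" for A
    proof (rule mat_prod_list_commute[symmetric])
      show "A' ** A = A ** A'" if "A' \<in> set As" for A'
        using As \<open>T \<subseteq> S\<close> \<open>A \<in> S\<close> that by (intro comm) auto
    qed
    \<comment> \<open>Bilinear extension, one factor at a time: first \<open>A'\<close> ranges over
      the span against \<open>C\<close> in \<open>S\<close>, then \<open>A\<close> does.\<close>
    have span_comm: "A ** A' = A' ** A" if "A \<in> mats.span S" "A' \<in> mats.span S" for A A'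
    proof (rule span_commute[OF _ that(1)])
      show "C ** A' = A' ** C" if "C \<in> S" for C
        by (rule span_commute[OF comm \<open>A' \<in> mats.span S\<close>, symmetric]) (use that in auto)
    qed
    show "mat_prod_list As \<in> mats.span S"
      using orbit span_comm span_commute[OF prod_comm] by (rule open_orbit_commutant_subset)
  qed
qed (rule mats.subspace_span)

text \<open>Each generator is the monomial of a one-element list.\<close>

lemma span_subset_poly_algebra: "mats.span S \<subseteq> poly_algebra S"
  unfolding poly_algebra_def
proof (rule mats.span_mono, rule subsetI)
  fix A assume "A \<in> S"
  then show "A \<in> {mat_prod_list As | As. set As \<subseteq> S}"
    by (auto simp: mat_prod_list_def intro!: exI[of _ "[A]"])
qed

theorem theorem5p1:
  fixes S B :: "('a::field_char_0^'n^'n) set"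
  assumes "card S = CARD('n)"
    and "mats.independent S"
    and "\<And>A A'. A \<in> S \<Longrightarrow> A' \<in> S \<Longrightarrow> A ** A' = A' ** A"
    and "B = mats.span S"
    and "has_open_orbit B"
  shows "(\<forall>p T. 1 \<le> p \<and> p \<le> CARD('n) \<and> T \<subseteq> S \<and> card T = p
           \<longrightarrow> mats.dim (poly_algebra T) \<le> CARD('n))
         \<and> poly_algebra S = B"
proof -
  have sub: "poly_algebra T \<subseteq> mats.span S" if "T \<subseteq> S" for T
    using poly_algebra_subset_span[OF assms(3) _ that] assms(4,5) by simp
  \<comment> \<open>An infinite set has \<open>card\<close> 0, whereas \<open>CARD('n)\<close> is
    positive.\<close>
  have "finite S"
    using assms(1) by (simp add: card_ge_0_finite)
  then have "mats.dim (poly_algebra T) \<le> CARD('n)" if "T \<subseteq> S" for T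
    using mats.dim_le_card[OF sub[OF that]] assms(1) by simp
  moreover have "poly_algebra S = B"
    using sub[of S] span_subset_poly_algebra[of S] assms(4) by blast
  ultimately show ?thesis
    by blast
qed

end
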